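(* Let $\mathbb P,\mathbb X,\mathbb Y$ be real Banach spaces, let $C$ be a closed convex cone with $\{\mathbf 0\}\subsetneqq C\subsetneqq\mathbb Y$, let $\varphi:\mathbb P\times\mathbb X\to\mathbb R$, and let $F:\mathbb P\times\mathbb X\rightrightarrows\mathbb Y$ be a set-valued mapping with nonempty closed values. For $p\in\mathbb P$ let $(\mathsf P_p)$ be the problem of minimizing $\varphi(p,x)$ over $x\in\mathbb X$ subject to $F(p,x)\subseteq C$, and put $\mathsf R(p)=\{x\in\mathbb X\mid F(p,x)\subseteq C\}$, $\mathsf{val}(p)=\inf_{x\in\mathsf R(p)}\varphi(p,x)$, $\mathsf{Argmin}(p)=\{x\in\mathsf R(p)\mid\varphi(p,x)=\mathsf{val}(p)\}$. Let $\bar p\in\mathbb P$ and $\bar x\in\mathsf{Argmin}(\bar p)$. Suppose that: (i) $\varphi(\bar p,\cdot)$ is lower semicontinuous at $\bar x$; (ii) $\varphi$ is calm from above in $p$ at $\bar p$, uniformly in $x$ near $\bar x$, i.e. there exist positive $\gamma$ and $r_\gamma$ such that $$\varphi(p,x)-\varphi(\bar p,x)\le\gamma\|p-\bar p\|,\quad\forall p\in\mathrm B[\bar p;r_\gamma],\ \forall x\in\mathrm B[\bar x;r_\gamma];$$ (iii) there exist positive $\beta$ and $r_\beta$ such that $$\mathrm{dist}\bigl(\bar p;\{p\in\mathbb P\mid F(p,x)\subseteq C\}\bigr)\le\beta\,\mathrm{exc}(F(\bar p,x);C),\quad\forall x\in\mathrm B[\bar x;r_\beta];$$ (iv) $(\mathsf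 P_{\bar p})$ is calm at $\bar x$. Then $(\mathsf P_{\bar p})$ admits a penalty function at $\bar x$.
   Context: Conventions: $\inf\varnothing=+\infty$, so the distance to the empty set is $+\infty$. $\mathrm B[x;r]$ is the closed ball; $\mathrm{dist}(y;S)=\inf_{s\in S}\|y-s\|$; $\mathrm{exc}(A;B)=\sup_{a\in A}\mathrm{dist}(a;B)$. Problem calmness: $(\mathsf P_{\bar p})$ is calm at $\bar x\in\mathsf{Argmin}(\bar p)$ if there exist $r,\lambda>0$ such that $$\inf_{p\in\mathrm B[\bar p;r]\setminus\{\bar p\}}\ \inf_{x\in\mathrm B[\bar x;r]\cap\mathsf R(p)}\frac{\varphi(p,x)-\varphi(\bar p,\bar x)}{\|p-\bar p\|}\ge-\lambda.$$ Penalty function: $(\mathsf P_{\bar p})$ admits a penalty function at a local solution $\bar x$ if there exists $\lambda_*\ge0$ such that for every $\lambda\in(\lambda_*,+\infty)$ the point $\bar x$ is an unconstrained local minimizer of $x\mapsto\varphi(\bar p,x)+\lambda\,\mathrm{exc}(F(\bar p,x);C)$ on $\mathbb X$. *)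

theory Defs
  imports "HOL-Analysis.Analysis"
begin

text \<open>Distance and excess are extended-real valued. The library's \<open>infdist\<close> and \<open>setdist\<close>
  are not usable here: they give distance \<open>0\<close> to the empty set, and they cannot express an
  infinite excess. In \<^typ>\<open>ereal\<close> the infimum over the empty set is \<open>\<infinity>\<close>.\<close>

definition ext_dist :: "'a::real_normed_vector \<Rightarrow> 'a set \<Rightarrow> ereal" where
  "ext_dist y S = (INF s\<in>S. ereal (norm (y - s)))"

text \<open>Only meant for nonempty \<open>A\<close> (the supremum over the empty set is \<open>- \<infinity>\<close> in \<^typ>\<open>ereal\<close>).\<close>

definition exc :: "'a::real_normed_vector set \<Rightarrow> 'a set \<Rightarrow> ereal" where
  "exc A B = (SUP a\<in>A. ext_dist a B)"

definition lsc_at :: "'a::topological_space \<Rightarrow> ('a \<Rightarrow> real) \<Rightarrow> bool" where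
  "lsc_at x f \<longleftrightarrow> (\<forall>c<f x. \<forall>\<^sub>F y in nhds x. c < f y)"

definition local_minimizer :: "('a::topological_space \<Rightarrow> ereal) \<Rightarrow> 'a \<Rightarrow> bool" where
  "local_minimizer f x \<longleftrightarrow> (\<forall>\<^sub>F y in nhds x. f x \<le> f y)"

text \<open>The parametric problem \<open>(P\<^sub>p)\<close>: minimize \<open>\<phi> p x\<close> over \<open>x\<close> subject to \<open>F p x \<subseteq> C\<close>.\<close>

definition feasible ::
    "('p \<Rightarrow> 'x \<Rightarrow> 'y set) \<Rightarrow> 'y set \<Rightarrow> 'p \<Rightarrow> 'x set" where
  "feasible F C p = {x. F p x \<subseteq> C}"

definition opt_val ::
    "('p \<Rightarrow> 'x \<Rightarrow> real) \<Rightarrow> ('p \<Rightarrow> 'x \<Rightarrow> 'y set) \<Rightarrow> 'y set \<Rightarrow> 'p \<Rightarrow> ereal" where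
  "opt_val \<phi> F C p = (INF x\<in>feasible F C p. ereal (\<phi> p x))"

definition Argmin ::
    "('p \<Rightarrow> 'x \<Rightarrow> real) \<Rightarrow> ('p \<Rightarrow> 'x \<Rightarrow> 'y set) \<Rightarrow> 'y set \<Rightarrow> 'p \<Rightarrow> 'x set" where
  "Argmin \<phi> F C p = {x \<in> feasible F C p. ereal (\<phi> p x) = opt_val \<phi> F C p}"

definition problem_calm ::
    "('p::real_normed_vector \<Rightarrow> 'x::real_normed_vector \<Rightarrow> real) \<Rightarrow> ('p \<Rightarrow> 'x \<Rightarrow> 'y set) \<Rightarrow>
     'y set \<Rightarrow> 'p \<Rightarrow> 'x \<Rightarrow> bool" where
  "problem_calm \<phi> F C p0 x0 \<longleftrightarrow>
     (\<exists>r>0. \<exists>\<kappa>>0.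
       (INF p\<in>cball p0 r - {p0}. INF x\<in>cball x0 r \<inter> feasible F C p.
          ereal ((\<phi> p x - \<phi> p0 x0) / norm (p - p0))) \<ge> ereal (- \<kappa>))"

definition admits_penalty ::
    "('p \<Rightarrow> 'x::real_normed_vector \<Rightarrow> real) \<Rightarrow> ('p \<Rightarrow> 'x \<Rightarrow> 'y::real_normed_vector set) \<Rightarrow>
     'y set \<Rightarrow> 'p \<Rightarrow> 'x \<Rightarrow> bool" where
  "admits_penalty \<phi> F C p0 x0 \<longleftrightarrow>
     (\<exists>\<kappa>0\<ge>0. \<forall>\<kappa>>\<kappa>0.
        local_minimizer (\<lambda>x. ereal (\<phi> p0 x) + ereal \<kappa> * exc (F p0 x) C) x0)"

end

theory Submission
  imports Defs
begin

text \<open>Let \<open>e\<close> be the excess of \<open>F pbar x\<close> beyond \<open>C\<close>. If \<open>e\<close> is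
  infinite, so is the penalty. If it is finite and positive, then for every constant above \<open>\<beta>\<close>
  hypothesis (iii) gives a parameter \<open>p\<close> for which \<open>x\<close> is feasible and whose distance from \<open>pbar\<close>
  is less than that constant times \<open>e\<close>.
  Going from \<open>pbar\<close> to \<open>p\<close> at \<open>x\<close> costs at most \<open>\<gamma>\<close> times that distance, by (ii), and calmness
  of the problem with constant \<open>\<kappa>\<close> bounds the gain of the perturbed feasible point over the
  optimum by \<open>\<kappa>\<close> times the distance. Hence \<open>\<phi> pbar x\<close> falls below \<open>\<phi> pbar xbar\<close> by at most
  about \<open>(\<kappa> + \<gamma>) * \<beta> * e\<close>, and every penalty parameter above \<open>\<beta> * (\<kappa> + \<gamma>)\<close> compensates this
  loss.

  This needs \<open>p\<close> to lie in the balls where (ii) and (iv) hold, that is, a small \<open>e\<close>. Since \<open>e\<close>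
  need not depend continuously on \<open>x\<close>, a large \<open>e\<close> cannot be excluded by shrinking the
  neighbourhood of \<open>xbar\<close>. Lower semicontinuity covers that case: near \<open>xbar\<close> the objective drops
  by less than a prescribed amount, which the penalty term already makes up for. Finally, \<open>e = 0\<close> means
  that \<open>x\<close> is feasible for \<open>pbar\<close>, because \<open>C\<close> is closed, and then optimality of \<open>xbar\<close>
  applies directly.\<close>

lemma ext_dist_nonneg: "0 \<le> ext_dist y S"
  unfolding ext_dist_def by (rule INF_greatest) simp

lemma ext_dist_less_iff: "ext_dist y S < ereal d \<longleftrightarrow> (\<exists>s\<in>S. norm (y - s) < d)"
  unfolding ext_dist_def by (simp add: INF_less_iff)

lemma ext_dist_eq_0_iff:
  assumes "closed S"
  shows "ext_dist y S = 0 \<longleftrightarrow> y \<in> S"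
proof
  assume "ext_dist y S = 0"
  then have "\<exists>s\<in>S. norm (y - s) < d" if "d > 0" for d
    using ext_dist_less_iff[of y S d] that by (simp add: zero_ereal_def)
  then have "\<forall>d>0. \<exists>s\<in>S. dist s y < d"
    by (metis dist_norm dist_commute)
  then show "y \<in> S"
    using assms closed_approachable by blast
next
  assume "y \<in> S"
  then have "ext_dist y S \<le> 0"
    unfolding ext_dist_def by (auto intro!: INF_lower2[of y] simp: zero_ereal_def)
  then show "ext_dist y S = 0"
    using ext_dist_nonneg[of y S] by (rule antisym)
qed

text \<open>Nonemptiness excludes the value \<open>- \<infinity>\<close> that the supremum assigns to the empty set.\<close>

lemma exc_nonneg:
  assumes "A \<noteq> {}"
  shows "0 \<le> exc A B"
proof -
  obtain a where "a \<in> A" using assms by blast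
  then show ?thesis
    unfolding exc_def by (rule SUP_upper2) (rule ext_dist_nonneg)
qed

lemma exc_eq_0_iff:
  assumes "A \<noteq> {}" and "closed B"
  shows "exc A B = 0 \<longleftrightarrow> A \<subseteq> B"
proof -
  have "exc A B = 0 \<longleftrightarrow> exc A B \<le> 0"
    using exc_nonneg[OF assms(1), of B] by auto
  also have "\<dots> \<longleftrightarrow> (\<forall>a\<in>A. ext_dist a B \<le> 0)"
    unfolding exc_def by (rule SUP_le_iff)
  also have "\<dots> \<longleftrightarrow> (\<forall>a\<in>A. ext_dist a B = 0)"
    using ext_dist_nonneg by (metis antisym order_refl)
  also have "\<dots> \<longleftrightarrow> A \<subseteq> B"
    using ext_dist_eq_0_iff[OF assms(2)] by blast
  finally show ?thesis .
qed

lemma Argmin_le: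
  assumes "x0 \<in> Argmin \<phi> F C p" and "x \<in> feasible F C p"
  shows "\<phi> p x0 \<le> \<phi> p x"
proof -
  have "ereal (\<phi> p x0) \<le> ereal (\<phi> p x)"
    using assms unfolding Argmin_def opt_val_def by (auto intro: INF_lower)
  then show ?thesis by simp
qed

text \<open>Multiplying out the quotient turns calmness into a linear lower bound; at \<open>p = p0\<close>,
  where calmness is silent, optimality of \<open>x0\<close> supplies the bound.\<close>

lemma problem_calm_lower_bound:
  assumes "problem_calm \<phi> F C p0 x0" and opt: "x0 \<in> Argmin \<phi> F C p0"
  obtains r \<kappa> where "r > 0" "\<kappa> > 0"
    "\<And>p x. p \<in> cball p0 r \<Longrightarrow> x \<in> cball x0 r \<Longrightarrow> F p x \<subseteq> C \<Longrightarrow>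
      \<phi> p0 x0 - \<kappa> * norm (p - p0) \<le> \<phi> p x"
proof -
  obtain r \<kappa> where rk: "r > 0" "\<kappa> > 0"
    and inf: "ereal (- \<kappa>) \<le> (INF p\<in>cball p0 r - {p0}. INF x\<in>cball x0 r \<inter> feasible F C p.
          ereal ((\<phi> p x - \<phi> p0 x0) / norm (p - p0)))"
    using assms(1) unfolding problem_calm_def by blast
  have "\<phi> p0 x0 - \<kappa> * norm (p - p0) \<le> \<phi> p x"
    if p: "p \<in> cball p0 r" and x: "x \<in> cball x0 r" and feas: "F p x \<subseteq> C" for p x
  proof (cases "p = p0")
    case True
    then show ?thesis
      using Argmin_le[OF opt, of x] feas by (simp add: feasible_def)
  next
    case False
    have "p \<in> cball p0 r - {p0}" "x \<in> cball x0 r \<inter> feasible F C p"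
      using p x feas False by (auto simp: feasible_def)
    then have "ereal (- \<kappa>) \<le> ereal ((\<phi> p x - \<phi> p0 x0) / norm (p - p0))"
      using inf unfolding le_INF_iff by blast
    then have "- \<kappa> * norm (p - p0) \<le> \<phi> p x - \<phi> p0 x0"
      using False by (simp add: pos_le_divide_eq)
    then show ?thesis by simp
  qed
  with rk show thesis by (rule that)
qed

theorem theorem4p4:
  fixes \<phi> :: "'p::banach \<Rightarrow> 'x::banach \<Rightarrow> real"
    and F :: "'p \<Rightarrow> 'x \<Rightarrow> 'y::banach set"
    and C :: "'y set" and pbar :: 'p and xbar :: 'x
  assumes "closed C" and "convex C" and "cone C"
    and "{0} \<subset> C" and "C \<subset> UNIV"
    and "\<And>p x. F p x \<noteq> {}" and "\<And>p x. closed (F p x)"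
    and "xbar \<in> Argmin \<phi> F C pbar"
    and i: "lsc_at xbar (\<phi> pbar)"
    and ii: "\<exists>\<gamma>>0. \<exists>r>0. \<forall>p\<in>cball pbar r. \<forall>x\<in>cball xbar r.
               \<phi> p x - \<phi> pbar x \<le> \<gamma> * norm (p - pbar)"
    and iii: "\<exists>\<beta>>0. \<exists>r>0. \<forall>x\<in>cball xbar r.
               ext_dist pbar {p. F p x \<subseteq> C} \<le> ereal \<beta> * exc (F pbar x) C"
    and iv: "problem_calm \<phi> F C pbar xbar"
  shows "admits_penalty \<phi> F C pbar xbar"
proof -
  obtain \<gamma> r1 where g: "\<gamma> > 0" "r1 > 0"
    and up: "\<And>p x. p \<in> cball pbar r1 \<Longrightarrow> x \<in> cball xbar r1 \<Longrightarrow>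
      \<phi> p x - \<phi> pbar x \<le> \<gamma> * norm (p - pbar)"
    using ii by blast
  obtain \<beta> r2 where b: "\<beta> > 0" "r2 > 0"
    and reg: "\<And>x. x \<in> cball xbar r2 \<Longrightarrow>
      ext_dist pbar {p. F p x \<subseteq> C} \<le> ereal \<beta> * exc (F pbar x) C"
    using iii by blast
  obtain r3 \<kappa> where k: "r3 > 0" "\<kappa> > 0"
    and calm: "\<And>p x. p \<in> cball pbar r3 \<Longrightarrow> x \<in> cball xbar r3 \<Longrightarrow> F p x \<subseteq> C \<Longrightarrow>
      \<phi> pbar xbar - \<kappa> * norm (p - pbar) \<le> \<phi> p x"
    using problem_calm_lower_bound[OF iv \<open>xbar \<in> Argmin \<phi> F C pbar\<close>] by metis
  define r where "r = min r1 (min r2 r3)"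
  have r: "r > 0" "r \<le> r1" "r \<le> r2" "r \<le> r3"
    using g b k by (auto simp: r_def)
  have exc_xbar: "exc (F pbar xbar) C = 0"
    using assms(1,6,8) by (simp add: exc_eq_0_iff Argmin_def feasible_def)
  have "local_minimizer (\<lambda>x. ereal (\<phi> pbar x) + ereal \<mu> * exc (F pbar x) C) xbar"
    if mu: "\<mu> > \<beta> * (\<kappa> + \<gamma>)" for \<mu>
    unfolding local_minimizer_def
  proof -
    have "\<mu> > 0"
      using mu b k g by (meson add_pos_pos mult_pos_pos order.strict_trans)
    have sum_pos: "\<kappa> + \<gamma> > 0" using k g by simp
    \<comment> \<open>The amount \<open>(\<kappa> + \<gamma>) * r\<close> is chosen so that a penalty term below it forces the
      perturbed parameter, which is picked closer than \<open>\<mu> * e / (\<kappa> + \<gamma>)\<close>, into the ball of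
      radius \<open>r\<close>.\<close>
    have "\<forall>\<^sub>F x in nhds xbar. \<phi> pbar xbar - (\<kappa> + \<gamma>) * r < \<phi> pbar x"
      using i sum_pos r(1) unfolding lsc_at_def by simp
    moreover have "\<forall>\<^sub>F x in nhds xbar. x \<in> cball xbar r"
      using eventually_nhds_ball[OF r(1), of xbar] by (rule eventually_mono) auto
    ultimately show "\<forall>\<^sub>F x in nhds xbar. ereal (\<phi> pbar xbar) + ereal \<mu> * exc (F pbar xbar) C
        \<le> ereal (\<phi> pbar x) + ereal \<mu> * exc (F pbar x) C"
    proof eventually_elim
      case (elim x)
      have exc0: "0 \<le> exc (F pbar x) C" using assms(6) by (rule exc_nonneg)
      have "ereal (\<phi> pbar xbar) \<le> ereal (\<phi> pbar x) + ereal \<mu> * exc (F pbar x) C"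
      proof (cases "exc (F pbar x) C")
        case PInf
        then show ?thesis using \<open>\<mu> > 0\<close> by simp
      next
        case MInf
        then show ?thesis using exc0 by simp
      next
        case (real e)
        have "e \<ge> 0" using exc0 real by simp
        have "\<phi> pbar xbar \<le> \<phi> pbar x + \<mu> * e"
        proof (cases "e = 0")
          case True
          then have "x \<in> feasible F C pbar"
            using exc_eq_0_iff[OF assms(6) assms(1)] real
            by (simp add: feasible_def zero_ereal_def)
          then show ?thesis
            using Argmin_le assms(8) True by fastforce
        next
          case False
          with \<open>e \<ge> 0\<close> have "e > 0" by simp
          show ?thesis
          proof (cases "\<mu> * e \<ge> (\<kappa> + \<gamma>) * r")
            case True
            then show ?thesis using elim(1) by linarith
          next
            case small: False
            \<comment> \<open>The distance in (iii) need not be attained; the strict inequality for \<open>\<mu>\<close> leaves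
              room for an almost nearest parameter.\<close>
            define d where "d = \<mu> * e / (\<kappa> + \<gamma>)"
            have d: "(\<kappa> + \<gamma>) * d = \<mu> * e" using sum_pos by (simp add: d_def)
            have "d < r"
              using small sum_pos by (simp add: d_def pos_divide_less_eq mult.commute)
            have "\<beta> * (\<kappa> + \<gamma>) * e < \<mu> * e"
              using mu \<open>e > 0\<close> by (rule mult_strict_right_mono)
            then have "\<beta> * e < d"
              using sum_pos by (simp add: d_def pos_less_divide_eq mult_ac)
            then have "ext_dist pbar {p. F p x \<subseteq> C} < ereal d"
              using reg[of x] elim(2) r(3) real by (auto intro: order.strict_trans1)
            then obtain p where p: "F p x \<subseteq> C" "norm (pbar - p) < d"
              unfolding ext_dist_less_iff by blast
            have pd: "norm (p - pbar) < d" using p(2) by (simp add: norm_minus_commute)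
            have p_near: "p \<in> cball pbar r1" "p \<in> cball pbar r3"
              using p(2) \<open>d < r\<close> r by (auto simp: dist_norm)
            have x_near: "x \<in> cball xbar r1" "x \<in> cball xbar r3"
              using elim(2) r by auto
            have "\<phi> pbar xbar - \<phi> pbar x \<le> (\<kappa> + \<gamma>) * norm (p - pbar)"
              using up[OF p_near(1) x_near(1)] calm[OF p_near(2) x_near(2) p(1)]
              by (simp add: algebra_simps)
            also have "\<dots> \<le> (\<kappa> + \<gamma>) * d"
              using pd sum_pos by (intro mult_left_mono) auto
            finally show ?thesis using d by simp
          qed
        qed
        then show ?thesis using real by simp
      qed
      then show ?case by (simp add: exc_xbar)
    qed
  qed
  moreover have "0 \<le> \<beta> * (\<kappa> + \<gamma>)" using b k g by simp
  ultimately show ?thesis unfolding admits_penalty_def by blast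
qed

end
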